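(* Let $\mathsf X,\mathsf Y$ be Banach spaces, $T>0$, $X\subset\mathsf X$ open and connected, and let $f\in C^2(X\times(0,T);\mathsf Y)$ be such that $f(\cdot,t):X\to\mathsf Y$ is a Fredholm map of index $0$ for every $t\in(0,T)$. Suppose that $f$ satisfies the transversality conditions (i.e. (T1), (T2), (T3) hold at every point of its singular set $\mathcal S$). Then for every $t\in(0,T)$ the set $\mathcal C(t):=\{x\in X: f(x,t)=0\}$ consists of isolated points.
   Context: A bounded linear operator $L\in\mathcal L(\mathsf X;\mathsf Y)$ is Fredholm if $\dim\mathsf N(L)$ and $\operatorname{codim}\mathsf R(L)$ are finite ($\mathsf N$ = kernel, $\mathsf R$ = range); its index is $\dim\mathsf N(L)-\operatorname{codim}\mathsf R(L)$. A $C^1$ map on a connected open set is a Fredholm map of index $k$ if its differential at every point is a Fredholm operator (of index $k$). $L^*\in\mathcal L(\mathsf Y^*;\mathsf X^* )$ is the adjoint of $L$. $D_xf$, $D_x^2f$ are the partial differentials with respect to $x\in\mathsf X$, and $\partial_tf$ is the partial derivative in $t$. Define $\mathcal C:=\{(x,t)\in X\times(0,T): f(x,t)=0\}$ and $\mathcal S:=\{(x,t)\in\mathcal C: D_xf(x,t)\text{ is not invertible}\}$. Transversality conditions at a point $(x_0,t_0)\in\mathcal S$: (T1) $\dim\mathsf N(D_xf(x_0,t_0))=1$; (T2) if $0\neq\ell^*\in\mathsf N(D_xf(x_0,t_0)^* )$, then ${}_{\mathsf Y^*}\langle\ell^*,\partial_tf(x_0,t_0)\rangle_{\mathsf Y}\neq0$;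 (T3) if $0\neq v\in\mathsf N(D_xf(x_0,t_0))$ and $0\neq\ell^*\in\mathsf N(D_xf(x_0,t_0)^* )$, then ${}_{\mathsf Y^*}\langle\ell^*,D_x^2f(x_0,t_0)[v,v]\rangle_{\mathsf Y}\neq0$. $f$ satisfies the transversality conditions if they hold at every point of $\mathcal S$. *)

theory Defs
  imports "HOL-Analysis.Analysis"
begin

section \<open>Bounded linear operators\<close>

definition null_space :: "('a::real_normed_vector \<Rightarrow>\<^sub>L 'b::real_normed_vector) \<Rightarrow> 'a set" where
  "null_space L = {x. blinfun_apply L x = 0}"

definition range_space :: "('a::real_normed_vector \<Rightarrow>\<^sub>L 'b::real_normed_vector) \<Rightarrow> 'b set" where
  "range_space L = range (blinfun_apply L)"

definition blinfun_invertible :: "('a::real_normed_vector \<Rightarrow>\<^sub>L 'b::real_normed_vector) \<Rightarrow> bool" where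
  "blinfun_invertible L \<longleftrightarrow> (\<exists>M. M o\<^sub>L L = id_blinfun \<and> L o\<^sub>L M = id_blinfun)"

lift_definition blinfun_adjoint ::
  "('a::real_normed_vector \<Rightarrow>\<^sub>L 'b::real_normed_vector) \<Rightarrow> ('b \<Rightarrow>\<^sub>L real) \<Rightarrow>\<^sub>L ('a \<Rightarrow>\<^sub>L real)"
  is "\<lambda>L l. l o\<^sub>L L"
  by (rule bounded_bilinear.bounded_linear_left[OF bounded_bilinear_blinfun_compose])

lemma blinfun_adjoint_apply:
  "blinfun_apply (blinfun_apply (blinfun_adjoint L) l) x = blinfun_apply l (blinfun_apply L x)"
  by transfer simp


section \<open>Dimension, codimension and Fredholm operators\<close>

definition fin_dim :: "'a::real_vector set \<Rightarrow> bool" where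
  "fin_dim V \<longleftrightarrow> (\<exists>B. finite B \<and> span B = V)"

text \<open>\<open>B\<close> is a set of representatives, one for each class, of a basis of the quotient by \<open>W\<close>.\<close>

definition quotient_basis :: "'a::real_vector set \<Rightarrow> 'a set \<Rightarrow> bool" where
  "quotient_basis W B \<longleftrightarrow>
     independent B \<and> span B \<inter> W = {0} \<and> (\<forall>y. \<exists>b \<in> span B. y - b \<in> W)"

definition fin_codim :: "'a::real_vector set \<Rightarrow> bool" where
  "fin_codim W \<longleftrightarrow> (\<exists>B. finite B \<and> quotient_basis W B)"

text \<open>Like \<^const>\<open>dim\<close>, this is \<open>0\<close> when the codimension is infinite.\<close>

definition codim :: "'a::real_vector set \<Rightarrow> nat" where
  "codim W = (if fin_codim W then card (SOME B. finite B \<and> quotient_basis W B) else 0)"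

lemma quotient_basis_card_le:
  fixes W :: "'a::real_vector set"
  assumes W: "subspace W"
    and B: "finite B" "quotient_basis W B"
    and C: "quotient_basis W C"
  shows "finite C \<and> card C \<le> card B"
proof -
  have "\<forall>y. \<exists>b \<in> span B. y - b \<in> W"
    using B(2) by (simp add: quotient_basis_def)
  then obtain p where p: "\<And>y. p y \<in> span B" "\<And>y. y - p y \<in> W" by metis
  have BW: "b = 0" if "b \<in> span B" "b \<in> W" for b
    using B(2) that by (auto simp: quotient_basis_def)
  have uniq: "p y = b" if "b \<in> span B" "y - b \<in> W" for y b
  proof -
    have "p y - b = (y - b) - (y - p y)" by simp
    then have "p y - b \<in> W" using subspace_diff[OF W that(2) p(2)] by metis
    moreover have "p y - b \<in> span B" using p(1) that(1) by (rule span_diff)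
    ultimately show ?thesis using BW by fastforce
  qed
  have lin: "linear p"
  proof (rule linearI)
    fix x y
    have "(x + y) - (p x + p y) = (x - p x) + (y - p y)" by simp
    then have "(x + y) - (p x + p y) \<in> W"
      using subspace_add[OF W p(2)[of x] p(2)[of y]] by metis
    then show "p (x + y) = p x + p y"
      by (intro uniq span_add p)
  next
    fix r x
    have "r *\<^sub>R x - r *\<^sub>R p x \<in> W"
      using subspace_scale[OF W p(2)[of x], of r] by (simp add: scaleR_diff_right)
    then show "p (r *\<^sub>R x) = r *\<^sub>R p x"
      by (intro uniq span_scale p)
  qed
  have inj: "inj_on p (span C)"
  proof (rule inj_onI)
    fix x y assume xy: "x \<in> span C" "y \<in> span C" "p x = p y"
    have "x - y = (x - p x) - (y - p y)" using xy(3) by simp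
    then have "x - y \<in> W" using subspace_diff[OF W p(2)[of x] p(2)[of y]] by metis
    moreover have "x - y \<in> span C" using xy by (simp add: span_diff)
    ultimately show "x = y" using C by (force simp: quotient_basis_def)
  qed
  have "independent (p ` C)"
    using C by (intro linear_independent_injective_image[OF lin _ inj]) (simp add: quotient_basis_def)
  moreover have "p ` C \<subseteq> span B" using p by auto
  ultimately have "finite (p ` C)" "card (p ` C) \<le> card B"
    using independent_span_bound[OF B(1)] by auto
  moreover have "inj_on p C" using inj by (rule inj_on_subset) (rule span_superset)
  ultimately show ?thesis by (simp add: finite_image_iff card_image)
qed

lemma codim_eq_card:
  assumes "subspace W" "finite B" "quotient_basis W B"
  shows "codim W = card B"
proof -
  have fc: "fin_codim W" using assms by (auto simp: fin_codim_def)
  define C where "C = (SOME C. finite C \<and> quotient_basis W C)"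
  have "finite C \<and> quotient_basis W C"
    unfolding C_def by (rule someI[where x = B]) (use assms in simp)
  then have "card C = card B"
    using quotient_basis_card_le assms by (metis order_antisym)
  then show ?thesis using fc by (simp add: codim_def C_def)
qed

definition fredholm :: "('a::real_normed_vector \<Rightarrow>\<^sub>L 'b::real_normed_vector) \<Rightarrow> bool" where
  "fredholm L \<longleftrightarrow> fin_dim (null_space L) \<and> fin_codim (range_space L)"

text \<open>Meaningful only when \<^term>\<open>fredholm L\<close> holds.\<close>

definition fredholm_index :: "('a::real_normed_vector \<Rightarrow>\<^sub>L 'b::real_normed_vector) \<Rightarrow> int" where
  "fredholm_index L = int (dim (null_space L)) - int (codim (range_space L))"


section \<open>Differentials and Fredholm maps\<close>

definition differential ::
  "('a::real_normed_vector \<Rightarrow> 'b::real_normed_vector) \<Rightarrow> 'a \<Rightarrow> 'a \<Rightarrow>\<^sub>L 'b" where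
  "differential g x = Blinfun (frechet_derivative g (at x))"

lemma differential_eq:
  assumes "(g has_derivative blinfun_apply L) (at x)"
  shows "differential g x = L"
  unfolding differential_def frechet_derivative_at[OF assms, symmetric]
  by (rule blinfun_apply_inverse)

text \<open>The set \<open>S\<close> is meant to be open; the values of \<open>g\<close> outside \<open>S\<close> are then irrelevant.\<close>

definition C1_on ::
  "'a::real_normed_vector set \<Rightarrow> ('a \<Rightarrow> 'b::real_normed_vector) \<Rightarrow> bool" where
  "C1_on S g \<longleftrightarrow> (\<forall>x\<in>S. g differentiable (at x)) \<and> continuous_on S (differential g)"

definition C2_on ::
  "'a::real_normed_vector set \<Rightarrow> ('a \<Rightarrow> 'b::real_normed_vector) \<Rightarrow> bool" where
  "C2_on S g \<longleftrightarrow> C1_on S g \<and> C1_on S (differential g)"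

definition fredholm_map_on ::
  "'a::real_normed_vector set \<Rightarrow> int \<Rightarrow> ('a \<Rightarrow> 'b::real_normed_vector) \<Rightarrow> bool" where
  "fredholm_map_on S k g \<longleftrightarrow> open S \<and> connected S \<and> C1_on S g \<and>
     (\<forall>x\<in>S. fredholm (differential g x) \<and> fredholm_index (differential g x) = k)"


section \<open>Partial differentials and transversality conditions\<close>

definition Dx ::
  "('a::real_normed_vector \<times> real \<Rightarrow> 'b::real_normed_vector) \<Rightarrow> 'a \<Rightarrow> real \<Rightarrow> 'a \<Rightarrow>\<^sub>L 'b" where
  "Dx f x t = differential (\<lambda>x'. f (x', t)) x"

definition Dxx ::
  "('a::real_normed_vector \<times> real \<Rightarrow> 'b::real_normed_vector) \<Rightarrow> 'a \<Rightarrow> real \<Rightarrow> 'a \<Rightarrow>\<^sub>L 'a \<Rightarrow>\<^sub>L 'b" where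
  "Dxx f x t = differential (\<lambda>x'. Dx f x' t) x"

definition Dt ::
  "('a::real_normed_vector \<times> real \<Rightarrow> 'b::real_normed_vector) \<Rightarrow> 'a \<Rightarrow> real \<Rightarrow> 'b" where
  "Dt f x t = vector_derivative (\<lambda>s. f (x, s)) (at t)"

definition zero_set ::
  "('a \<times> real \<Rightarrow> 'b::zero) \<Rightarrow> 'a set \<Rightarrow> real \<Rightarrow> ('a \<times> real) set" where
  "zero_set f X T = {(x, t) \<in> X \<times> {0<..<T}. f (x, t) = 0}"

definition singular_set ::
  "('a::real_normed_vector \<times> real \<Rightarrow> 'b::real_normed_vector) \<Rightarrow> 'a set \<Rightarrow> real \<Rightarrow> ('a \<times> real) set" where
  "singular_set f X T = {(x, t) \<in> zero_set f X T. \<not> blinfun_invertible (Dx f x t)}"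

definition T1 ::
  "('a::real_normed_vector \<times> real \<Rightarrow> 'b::real_normed_vector) \<Rightarrow> 'a \<Rightarrow> real \<Rightarrow> bool" where
  "T1 f x t \<longleftrightarrow> dim (null_space (Dx f x t)) = 1"

definition T2 ::
  "('a::real_normed_vector \<times> real \<Rightarrow> 'b::real_normed_vector) \<Rightarrow> 'a \<Rightarrow> real \<Rightarrow> bool" where
  "T2 f x t \<longleftrightarrow> (\<forall>l \<in> null_space (blinfun_adjoint (Dx f x t)).
     l \<noteq> 0 \<longrightarrow> blinfun_apply l (Dt f x t) \<noteq> 0)"

definition T3 ::
  "('a::real_normed_vector \<times> real \<Rightarrow> 'b::real_normed_vector) \<Rightarrow> 'a \<Rightarrow> real \<Rightarrow> bool" where
  "T3 f x t \<longleftrightarrow> (\<forall>v \<in> null_space (Dx f x t). \<forall>l \<in> null_space (blinfun_adjoint (Dx f x t)).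
     v \<noteq> 0 \<longrightarrow> l \<noteq> 0 \<longrightarrow> blinfun_apply l (blinfun_apply (blinfun_apply (Dxx f x t) v) v) \<noteq> 0)"

definition transversality ::
  "('a::real_normed_vector \<times> real \<Rightarrow> 'b::real_normed_vector) \<Rightarrow> 'a set \<Rightarrow> real \<Rightarrow> bool" where
  "transversality f X T \<longleftrightarrow> (\<forall>(x, t) \<in> singular_set f X T. T1 f x t \<and> T2 f x t \<and> T3 f x t)"

end

theory Submission
  imports Defs
begin

text \<open>At a regular zero the differential is bounded below, so the zero is isolated. At a singular
  zero \<open>x\<close> with differential \<open>L\<close>, the open mapping theorem applied to \<open>(u, s) \<mapsto> L u + s w\<close>, where \<open>w\<close>
  spans a complement of the range, yields a nonzero bounded functional \<open>l\<close> that vanishes on the range,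
  together with the bound \<open>dist h (ker L) \<le> C \<parallel>L h\<parallel>\<close>. If \<open>x + h\<close> is another zero,
  the second-order expansion gives \<open>\<parallel>L h\<parallel> = O(\<parallel>h\<parallel>\<^sup>2)\<close>, so \<open>h = a v + O(\<parallel>h\<parallel>\<^sup>2)\<close> with \<open>v\<close> in the
  kernel, and applying \<open>l\<close> to the expansion gives \<open>a\<^sup>2 l(D\<^sup>2f[v,v]) = o(\<parallel>h\<parallel>\<^sup>2)\<close>, contradicting (T3)
  for small \<open>h\<close>.\<close>

section \<open>The open mapping theorem\<close>

text \<open>This is the Baire half of the open mapping theorem: countably many closures of images of
  balls cover the complete codomain, so one of them has interior. Preimages come only up to a
  relative error 1/2, which is what iteration can remove.\<close>

lemma surj_approx_preimage:
  fixes T :: "'a::real_normed_vector \<Rightarrow> 'b::banach"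
  assumes T: "bounded_linear T" and surj: "surj T"
  obtains K where "\<And>y. \<exists>x. norm x \<le> K * norm y \<and> norm (y - T x) \<le> norm y / 2"
proof -
  interpret T: bounded_linear T by fact
  define A where "A n = closure (T ` ball 0 (real n))" for n
  have "(\<Union>n. A n) = UNIV"
  proof -
    have "y \<in> (\<Union>n. A n)" for y
    proof -
      obtain x where x: "y = T x" using surj by (metis surjD)
      obtain n where "norm x < real n" using reals_Archimedean2 by blast
      then have "y \<in> T ` ball 0 (real n)" using x by auto
      then have "y \<in> A n" unfolding A_def by (rule subsetD[OF closure_subset])
      then show ?thesis by blast
    qed
    then show ?thesis by blast
  qed
  moreover have "completely_metrizable_space (euclidean :: 'b topology)"
    by (rule completely_metrizable_space_euclidean)
  \<comment> \<open>If every closed set \<open>A n\<close> had empty interior, Baire would forbid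
    their union from being the whole space.\<close>
  ultimately obtain n where "interior (A n) \<noteq> {}"
    using Baire_category_alt[of "euclidean :: 'b topology" "range A"]
    by (fastforce simp: A_def)
  then obtain y0 e where e: "e > 0" "ball y0 e \<subseteq> A n"
    by (metis all_not_in_conv mem_interior)
  \<comment> \<open>The unknown centre \<open>y0\<close> cancels: approximate preimages of
    \<open>y0 + y\<close> and of \<open>y0\<close>, each with error below e/8, are subtracted, which
    doubles the radius.\<close>
  have near: "\<exists>x. norm x \<le> 2 * real n \<and> norm (y - T x) \<le> e / 4" if y: "norm y < e" for y
  proof -
    have "y0 + y \<in> A n" "y0 \<in> A n" using e y by (auto simp: subset_iff dist_norm)
    moreover have "\<exists>x. norm x < n \<and> dist (T x) z < e / 8" if z: "z \<in> A n" for z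
    proof -
      have "e / 8 > 0" using e(1) by simp
      then obtain q where "q \<in> T ` ball 0 (real n)" "dist q z < e / 8"
        using z by (metis A_def closure_approachable)
      then show ?thesis by (auto simp: dist_norm)
    qed
    ultimately obtain x1 x2 where x: "norm x1 < n" "norm x2 < n"
      "dist (T x1) (y0 + y) < e / 8" "dist (T x2) y0 < e / 8"
      by meson
    have "y - T (x1 - x2) = (T x2 - y0) - (T x1 - (y0 + y))" by (simp add: T.diff)
    then have "norm (y - T (x1 - x2)) \<le> norm (T x2 - y0) + norm (T x1 - (y0 + y))"
      by (metis norm_triangle_ineq4)
    moreover have "norm (x1 - x2) \<le> norm x1 + norm x2" by (rule norm_triangle_ineq4)
    ultimately show ?thesis using x by (intro exI[of _ "x1 - x2"]) (auto simp: dist_norm)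
  qed
  show thesis
  proof (rule that[of "4 * real n / e"])
    fix y
    show "\<exists>x. norm x \<le> 4 * real n / e * norm y \<and> norm (y - T x) \<le> norm y / 2"
    proof (cases "y = 0")
      case True
      then show ?thesis by (intro exI[of _ 0]) (simp add: T.zero)
    next
      case False
      \<comment> \<open>The factor brings \<open>y\<close> to norm e/2, inside the ball covered by
        \<open>near\<close>. Scaling back turns the error e/4 into \<open>norm y / 2\<close> and the
        radius 2n into \<open>4 * real n / e * norm y\<close>.\<close>
      define c where "c = e / (2 * norm y)"
      have c: "c > 0" using False e by (simp add: c_def)
      have "norm (c *\<^sub>R y) < e" using False e by (simp add: c_def)
      then obtain x where x: "norm x \<le> 2 * real n" "norm (c *\<^sub>R y - T x) \<le> e / 4"
        using near by blast
      have "c *\<^sub>R (y - T (x /\<^sub>R c)) = c *\<^sub>R y - T x"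
        using c by (simp add: T.scaleR scaleR_diff_right)
      then have "c * norm (y - T (x /\<^sub>R c)) = norm (c *\<^sub>R y - T x)"
        using c by (metis abs_of_pos norm_scaleR)
      then have "norm (y - T (x /\<^sub>R c)) \<le> (e / 4) / c"
        using x c by (simp add: pos_le_divide_eq mult.commute)
      also have "\<dots> = norm y / 2" using e by (simp add: c_def)
      finally have "norm (y - T (x /\<^sub>R c)) \<le> norm y / 2" .
      moreover have "norm (x /\<^sub>R c) \<le> 2 * real n / c"
        using x c by (simp add: divide_right_mono field_simps)
      moreover have "2 * real n / c = 4 * real n / e * norm y" by (simp add: c_def)
      ultimately show ?thesis by (metis (no_types))
    qed
  qed
qed

text \<open>Approximate preimages of successive residuals are summed. The residuals halve each time,
  so the series converges absolutely in the complete domain and its sum is an exact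
  preimage.\<close>

theorem bounded_linear_surj_bounded_preimage:
  fixes T :: "'a::banach \<Rightarrow> 'b::banach"
  assumes T: "bounded_linear T" and surj: "surj T"
  obtains C where "C > 0" "\<And>y. \<exists>x. T x = y \<and> norm x \<le> C * norm y"
proof -
  interpret T: bounded_linear T by fact
  obtain K where "\<And>y. \<exists>x. norm x \<le> K * norm y \<and> norm (y - T x) \<le> norm y / 2"
    using surj_approx_preimage[OF assms] by blast
  then obtain p where p: "\<And>y. norm (p y) \<le> K * norm y" "\<And>y. norm (y - T (p y)) \<le> norm y / 2"
    by metis
  have ex: "\<exists>x. T x = y \<and> norm x \<le> (2 * \<bar>K\<bar> + 1) * norm y" for y
  proof -
    \<comment> \<open>\<open>r n\<close> is the residual left after n corrections. The images of the
      corrections are the differences of consecutive residuals, so their series telescopes to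
      \<open>y\<close>.\<close>
    define r where "r n = ((\<lambda>z. z - T (p z)) ^^ n) y" for n
    have r0: "r 0 = y" and rSuc: "T (p (r n)) = r n - r (Suc n)" for n
      by (simp_all add: r_def)
    have rn: "norm (r n) \<le> norm y * (1/2) ^ n" for n
    proof (induction n)
      case (Suc n)
      have "norm (r (Suc n)) \<le> norm (r n) / 2" using p(2)[of "r n"] by (simp add: r_def)
      then show ?case using Suc by simp
    qed (simp add: r0)
    have pn: "norm (p (r n)) \<le> \<bar>K\<bar> * norm y * (1/2) ^ n" for n
    proof -
      have "norm (p (r n)) \<le> K * norm (r n)" by (rule p)
      also have "\<dots> \<le> \<bar>K\<bar> * norm (r n)" by (intro mult_right_mono) auto
      also have "\<dots> \<le> \<bar>K\<bar> * (norm y * (1/2) ^ n)" by (intro mult_left_mono rn) auto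
      finally show ?thesis by (simp add: mult.assoc)
    qed
    have geo: "(\<lambda>n. \<bar>K\<bar> * norm y * (1/2) ^ n) sums (\<bar>K\<bar> * norm y * 2)"
      using sums_mult[OF geometric_sums[of "1/2 :: real"], of "\<bar>K\<bar> * norm y"] by simp
    have sn: "summable (\<lambda>n. norm (p (r n)))"
      by (rule summable_comparison_test'[OF sums_summable[OF geo], of 0]) (simp add: pn)
    define x where "x = (\<Sum>n. p (r n))"
    have "norm x \<le> (\<Sum>n. norm (p (r n)))"
      unfolding x_def by (rule summable_norm[OF sn])
    also have "\<dots> \<le> \<bar>K\<bar> * norm y * 2"
      using suminf_le[OF pn sn sums_summable[OF geo]] sums_unique[OF geo] by simp
    also have "\<dots> \<le> (2 * \<bar>K\<bar> + 1) * norm y" by (simp add: algebra_simps)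
    finally have nx: "norm x \<le> (2 * \<bar>K\<bar> + 1) * norm y" .
    have "(\<lambda>n. p (r n)) sums x"
      unfolding x_def by (rule summable_sums[OF summable_norm_cancel[OF sn]])
    then have "(\<lambda>n. r n - r (Suc n)) sums T x"
      using T.sums by (force simp flip: rSuc)
    moreover have "r \<longlonglongrightarrow> 0"
    proof (rule Lim_null_comparison)
      show "\<forall>\<^sub>F n in sequentially. norm (r n) \<le> norm y * (1/2) ^ n" using rn by simp
      show "(\<lambda>n. norm y * (1/2) ^ n) \<longlonglongrightarrow> 0"
        by (intro tendsto_mult_right_zero LIMSEQ_realpow_zero) auto
    qed
    then have "(\<lambda>n. r n - r (Suc n)) sums (r 0 - 0)" by (rule telescope_sums')
    ultimately have "T x = y" using sums_unique2 r0 by fastforce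
    then show ?thesis using nx by blast
  qed
  \<comment> \<open>The summand 1 keeps the constant positive when \<open>K = 0\<close>.\<close>
  show thesis by (rule that[of "2 * \<bar>K\<bar> + 1"]) (use ex in auto)
qed

section \<open>Operators with one-dimensional cokernel\<close>

text \<open>The range is not assumed closed. Adjoining the direction \<open>w\<close> gives a
  surjection of Banach spaces, and its bounded preimages control both coordinates: the one along
  \<open>w\<close> becomes \<open>l\<close>, and the other gives the bound on
  \<open>u\<close>.\<close>

lemma codim_1_functional:
  fixes L :: "'a::banach \<Rightarrow>\<^sub>L 'b::banach"
  assumes w: "quotient_basis (range_space L) {w}"
  obtains l :: "'b \<Rightarrow>\<^sub>L real" and C
  where "l \<noteq> 0" "l \<in> null_space (blinfun_adjoint L)" "C > 0"
    "\<And>h. \<exists>u. L u = L h \<and> norm u \<le> C * norm (L h)"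
proof -
  have w0: "w \<noteq> 0"
    using w unfolding quotient_basis_def by (auto simp: dependent_zero)
  have zero: "s = 0" if "s *\<^sub>R w = L u" for s u
  proof -
    have "s *\<^sub>R w \<in> span {w}" by (simp add: span_base span_scale)
    moreover have "s *\<^sub>R w \<in> range_space L" using that by (simp add: range_space_def)
    moreover have "span {w} \<inter> range_space L = {0}" using w by (simp add: quotient_basis_def)
    ultimately have "s *\<^sub>R w = 0" by blast
    then show ?thesis using w0 by simp
  qed
  have decomp: "\<exists>u s. y = L u + s *\<^sub>R w" for y
  proof -
    obtain b where "b \<in> span {w}" "y - b \<in> range_space L"
      using w unfolding quotient_basis_def by blast
    then obtain s u where "b = s *\<^sub>R w" "y - b = L u"
      by (auto simp: span_singleton range_space_def)
    then show ?thesis by (metis diff_add_cancel)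
  qed
  define P where "P = (\<lambda>(u, s). L u + s *\<^sub>R w)"
  have "bounded_linear P"
    unfolding P_def case_prod_unfold
    by (intro bounded_linear_add bounded_linear_compose[OF blinfun.bounded_linear_right]
        bounded_linear_compose[OF bounded_linear_scaleR_left] bounded_linear_fst bounded_linear_snd)
  moreover have "surj P"
    unfolding surj_def
  proof
    fix y
    obtain u s where "y = L u + s *\<^sub>R w" using decomp by blast
    then show "\<exists>z. y = P z" by (intro exI[of _ "(u, s)"]) (simp add: P_def)
  qed
  ultimately obtain C where C: "C > 0" "\<And>y. \<exists>z. P z = y \<and> norm z \<le> C * norm y"
    using bounded_linear_surj_bounded_preimage by blast
  have PC: "\<exists>u s. y = L u + s *\<^sub>R w \<and> norm (u, s) \<le> C * norm y" for y
  proof -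
    obtain z where "P z = y" "norm z \<le> C * norm y" using C(2) by blast
    then show ?thesis by (cases z) (auto simp: P_def)
  qed
  \<comment> \<open>\<open>\<sigma>\<close> is the coordinate along \<open>w\<close>. By
    \<open>zero\<close> it does not depend on the chosen decomposition, whence its
    linearity.\<close>
  obtain \<sigma> where \<sigma>: "\<And>y. \<exists>u. y = L u + \<sigma> y *\<^sub>R w" using decomp by metis
  have \<sigma>_eq: "\<sigma> (L u + s *\<^sub>R w) = s" for u s
  proof -
    obtain u' where "L u + s *\<^sub>R w = L u' + \<sigma> (L u + s *\<^sub>R w) *\<^sub>R w" using \<sigma> by blast
    then have "(\<sigma> (L u + s *\<^sub>R w) - s) *\<^sub>R w = L (u - u')"
      by (simp add: blinfun.diff_right algebra_simps)
    then show ?thesis using zero by fastforce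
  qed
  have \<sigma>_bl: "bounded_linear \<sigma>"
  proof (rule bounded_linear_intro[where K = C])
    fix y z
    obtain u v where "y = L u + \<sigma> y *\<^sub>R w" "z = L v + \<sigma> z *\<^sub>R w" using \<sigma> by metis
    then have "y + z = (L u + \<sigma> y *\<^sub>R w) + (L v + \<sigma> z *\<^sub>R w)" by (rule arg_cong2)
    also have "\<dots> = L (u + v) + (\<sigma> y + \<sigma> z) *\<^sub>R w"
      by (simp add: blinfun.add_right scaleR_left_distrib)
    finally show "\<sigma> (y + z) = \<sigma> y + \<sigma> z" by (metis \<sigma>_eq)
  next
    fix c y
    obtain u where "y = L u + \<sigma> y *\<^sub>R w" using \<sigma> by metis
    then have "c *\<^sub>R y = L (c *\<^sub>R u) + (c * \<sigma> y) *\<^sub>R w"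
      by (metis blinfun.scaleR_right scaleR_add_right scaleR_scaleR)
    then show "\<sigma> (c *\<^sub>R y) = c *\<^sub>R \<sigma> y" by (metis \<sigma>_eq real_scaleR_def)
  next
    fix y
    \<comment> \<open>Some decomposition has a bounded coefficient; by uniqueness that coefficient
      is \<open>\<sigma> y\<close>.\<close>
    obtain u s where us: "y = L u + s *\<^sub>R w" "norm (u, s) \<le> C * norm y"
      using PC by blast
    have "norm s \<le> norm (u, s)" using norm_snd_le by blast
    then show "norm (\<sigma> y) \<le> norm y * C" using us \<sigma>_eq by (metis dual_order.trans mult.commute)
  qed
  define l where "l = Blinfun \<sigma>"
  have l: "blinfun_apply l y = \<sigma> y" for y
    unfolding l_def by (simp add: bounded_linear_Blinfun_apply[OF \<sigma>_bl])
  have "l w = 1" using l \<sigma>_eq[of 0 1] by simp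
  then have "l \<noteq> 0" by auto
  moreover have "l (L u) = 0" for u using l \<sigma>_eq[of u 0] by simp
  then have "l \<in> null_space (blinfun_adjoint L)"
    by (auto simp: null_space_def blinfun_adjoint_apply intro!: blinfun_eqI)
  moreover have "\<exists>u. L u = L h \<and> norm u \<le> C * norm (L h)" for h
  proof -
    \<comment> \<open>For a vector of the range the \<open>w\<close> coordinate vanishes, so the
      bounded \<open>u\<close> is itself a preimage.\<close>
    obtain u s where us: "L h = L u + s *\<^sub>R w" "norm (u, s) \<le> C * norm (L h)"
      using PC by blast
    have "s *\<^sub>R w = L (h - u)" using us(1) by (simp add: blinfun.diff_right)
    then have "s = 0" by (rule zero)
    then show ?thesis using us by (metis add.right_neutral dual_order.trans norm_fst_le scaleR_zero_left)
  qed
  ultimately show thesis using that C(1) by blast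
qed

section \<open>Zeros of maps between Banach spaces\<close>

text \<open>The mean value inequality is applied on the segment from \<open>x0\<close> to
  \<open>x0 + h\<close>: differentiability of \<open>D\<close> at \<open>x0\<close> makes the
  derivative of the remainder along the segment at most \<open>e\<close> times the square of
  \<open>norm h\<close>.\<close>

lemma second_order_expansion:
  fixes g :: "'a::real_normed_vector \<Rightarrow> 'b::real_normed_vector"
    and D :: "'a \<Rightarrow> 'a \<Rightarrow>\<^sub>L 'b" and B :: "'a \<Rightarrow>\<^sub>L 'a \<Rightarrow>\<^sub>L 'b"
  assumes "open X" "x0 \<in> X"
    and g: "\<And>x. x \<in> X \<Longrightarrow> (g has_derivative D x) (at x)"
    and D: "(D has_derivative B) (at x0)"
    and e: "e > 0"
  obtains d where "d > 0"
    "\<And>h. norm h < d \<Longrightarrow> norm (g (x0 + h) - g x0 - D x0 h - (1/2) *\<^sub>R B h h) \<le> e * (norm h)\<^sup>2"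
proof -
  obtain d1 where d1: "d1 > 0" "ball x0 d1 \<subseteq> X"
    using assms(1,2) openE by blast
  obtain d2 where d2: "d2 > 0"
    "\<And>y. norm (y - x0) < d2 \<Longrightarrow> norm (D y - D x0 - B (y - x0)) \<le> e * norm (y - x0)"
    using D e unfolding has_derivative_at_alt by blast
  show thesis
  proof (rule that[of "min d1 d2"])
    fix h :: 'a assume h: "norm h < min d1 d2"
    \<comment> \<open>The quadratic term is chosen so that \<open>\<phi> 1 - \<phi> 0\<close> is
      exactly the remainder to be estimated.\<close>
    define \<phi> where "\<phi> (s :: real) = g (x0 + s *\<^sub>R h) - s *\<^sub>R D x0 h - (s\<^sup>2 / 2) *\<^sub>R B h h" for s
    define \<phi>' where "\<phi>' (s :: real) = D (x0 + s *\<^sub>R h) h - D x0 h - s *\<^sub>R B h h" for s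
    have sh: "norm (s *\<^sub>R h) \<le> norm h" if "s \<in> {0..1}" for s :: real
      using that by (simp add: mult_left_le_one_le)
    have der: "(\<phi> has_vector_derivative \<phi>' s) (at s)" if s: "s \<in> {0..1}" for s
    proof -
      have "x0 + s *\<^sub>R h \<in> X" using d1 h sh[OF s] by (auto simp: subset_iff dist_norm)
      then have "((\<lambda>s. g (x0 + s *\<^sub>R h)) has_derivative (\<lambda>r. D (x0 + s *\<^sub>R h) (r *\<^sub>R h))) (at s)"
        by (intro has_derivative_compose[OF _ g]) (auto intro!: derivative_eq_intros)
      then have 1: "((\<lambda>s. g (x0 + s *\<^sub>R h)) has_vector_derivative D (x0 + s *\<^sub>R h) h) (at s)"
        by (simp add: has_vector_derivative_def blinfun.scaleR_right)
      show ?thesis unfolding \<phi>_def \<phi>'_def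
        by (rule derivative_eq_intros 1 refl | simp)+
    qed
    have bnd: "norm (\<phi>' s) \<le> e * (norm h)\<^sup>2" if s: "s \<in> {0..1}" for s
    proof -
      have "\<phi>' s = (D (x0 + s *\<^sub>R h) - D x0 - B (s *\<^sub>R h)) h"
        by (simp add: \<phi>'_def blinfun.diff_left blinfun.scaleR_right blinfun.scaleR_left)
      then have "norm (\<phi>' s) \<le> norm (D (x0 + s *\<^sub>R h) - D x0 - B (s *\<^sub>R h)) * norm h"
        by (metis norm_blinfun)
      also have "\<dots> \<le> (e * norm (s *\<^sub>R h)) * norm h"
        using d2(2)[of "x0 + s *\<^sub>R h"] h sh[OF s] by (intro mult_right_mono) auto
      also have "\<dots> \<le> (e * norm h) * norm h"
        using e sh[OF s] by (intro mult_right_mono mult_left_mono) auto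
      finally show ?thesis by (simp add: power2_eq_square mult.assoc)
    qed
    have "norm (\<phi> 1 - \<phi> 0) \<le> e * (norm h)\<^sup>2 * 1 - e * (norm h)\<^sup>2 * 0"
    proof (rule differentiable_bound_general[where f' = \<phi>' and \<phi>' = "\<lambda>_. e * (norm h)\<^sup>2"])
      show "continuous_on {0..1} \<phi>"
        using der by (meson continuous_at_imp_continuous_on has_vector_derivative_continuous)
    qed (use der bnd in \<open>auto intro!: continuous_intros derivative_eq_intros\<close>)
    then show "norm (g (x0 + h) - g x0 - D x0 h - (1/2) *\<^sub>R B h h) \<le> e * (norm h)\<^sup>2"
      by (simp add: \<phi>_def algebra_simps)
  qed (use d1 d2 in auto)
qed

text \<open>Near \<open>x0\<close> the first-order remainder is at most half the lower bound for
  \<open>L h\<close>, so it cannot cancel \<open>L h\<close> unless \<open>h = 0\<close>.\<close>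

lemma isolated_zero_bounded_below:
  fixes g :: "'a::real_normed_vector \<Rightarrow> 'b::real_normed_vector"
  assumes g: "(g has_derivative L) (at x0)" and "g x0 = 0"
    and c: "c > 0" "\<And>h. c * norm h \<le> norm (L h)"
  shows "\<exists>d>0. \<forall>h. norm h < d \<longrightarrow> g (x0 + h) = 0 \<longrightarrow> h = 0"
proof -
  obtain d where d: "d > 0" "\<And>y. norm (y - x0) < d \<Longrightarrow>
      norm (g y - g x0 - L (y - x0)) \<le> c / 2 * norm (y - x0)"
    using g c(1) unfolding has_derivative_at_alt by (meson half_gt_zero)
  show ?thesis
  proof (intro exI[of _ d] conjI allI impI d(1))
    fix h assume h: "norm h < d" "g (x0 + h) = 0"
    have "norm (L h) \<le> c / 2 * norm h"
      using d(2)[of "x0 + h"] h assms(2) by simp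
    then have "c / 2 * norm h \<le> 0" using c(2)[of h] by simp
    then show "h = 0" using c(1) by (simp add: mult_le_0_iff)
  qed
qed

text \<open>For a nearby zero, h = a v + r with r quadratically small, so |a| is at least |h|/2 and
  a^2 \<open>\<beta>\<close> is at least \<open>\<beta>\<close> |h|^2 / 4. The expansion tested with
  \<open>l\<close> puts a^2 \<open>\<beta>\<close> strictly below the same quantity.\<close>

lemma isolated_zero_fold:
  fixes g :: "'a::banach \<Rightarrow> 'b::banach"
    and D :: "'a \<Rightarrow> 'a \<Rightarrow>\<^sub>L 'b" and B :: "'a \<Rightarrow>\<^sub>L 'a \<Rightarrow>\<^sub>L 'b"
  assumes X: "open X" "x0 \<in> X"
    and g: "\<And>x. x \<in> X \<Longrightarrow> (g has_derivative D x) (at x)"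
    and D: "(D has_derivative B) (at x0)"
    and g0: "g x0 = 0"
    and ker: "null_space (D x0) \<subseteq> span {v}" and v: "norm v = 1"
    and l: "l \<in> null_space (blinfun_adjoint (D x0))" "blinfun_apply l (B v v) \<noteq> 0"
    and C: "C > 0" "\<And>h. \<exists>u. D x0 u = D x0 h \<and> norm u \<le> C * norm (D x0 h)"
  shows "\<exists>d>0. \<forall>h. norm h < d \<longrightarrow> g (x0 + h) = 0 \<longrightarrow> h = 0"
proof -
  define \<beta> where "\<beta> = \<bar>blinfun_apply l (B v v)\<bar>"
  have \<beta>: "\<beta> > 0" using l(2) by (simp add: \<beta>_def)
  have lD: "blinfun_apply l (D x0 h) = 0" for h
    using l(1) by (auto simp: null_space_def simp flip: blinfun_adjoint_apply)
  \<comment> \<open>With this tolerance, \<open>l\<close> applied to the Taylor remainder costs at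
    most \<open>\<beta>\<close> |h|^2 / 16.\<close>
  define e where "e = \<beta> / (16 * (norm l + 1))"
  have e: "e > 0" using \<beta> by (simp add: e_def add_nonneg_pos)
  have "norm l * e \<le> (norm l + 1) * e" using e by simp
  also have "\<dots> = \<beta> / 16"
  proof -
    have "norm l + 1 \<noteq> 0" using norm_ge_zero[of l] by linarith
    then show ?thesis unfolding e_def by (simp add: divide_simps)
  qed
  finally have le: "norm l * e \<le> \<beta> / 16" .
  \<comment> \<open>\<open>K\<close> bounds |r| / |h|^2: \<open>C\<close> comes from solving for
    \<open>r\<close>, and \<open>norm B + e\<close> from the expansion estimate for
    \<open>D x0 h\<close>.\<close>
  define K where "K = C * (norm B + e)"
  have K: "K > 0" using C(1) e by (simp add: K_def add_nonneg_pos)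
  obtain d0 where d0: "d0 > 0" "\<And>h. norm h < d0 \<Longrightarrow>
      norm (g (x0 + h) - g x0 - D x0 h - (1/2) *\<^sub>R B h h) \<le> e * (norm h)\<^sup>2"
    using second_order_expansion[OF X g D e] by blast
  \<comment> \<open>\<open>M\<close> bounds \<open>l\<close> on the two cross terms of
    \<open>B h h\<close>; the 3 comes from |a| + |h| being at most 3 |h|.\<close>
  define M where "M = 3 * norm l * norm B * K"
  have M: "M \<ge> 0" using K by (simp add: M_def)
  \<comment> \<open>The three bounds give, in order: validity of the expansion, |r| at most |h|/2,
    and cross terms below \<open>\<beta>\<close> |h|^2 / 8.\<close>
  define d where "d = min d0 (min (1 / (2 * K)) (\<beta> / (8 * (M + 1))))"
  have d: "d > 0" using d0 K \<beta> M by (simp add: d_def)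
  show ?thesis
  proof (intro exI[of _ d] conjI allI impI d, rule ccontr)
    fix h assume h: "norm h < d" "g (x0 + h) = 0" "h \<noteq> 0"
    have hK: "norm h * K \<le> 1/2"
    proof -
      have "norm h \<le> 1 / (2 * K)" using h by (simp add: d_def)
      then show ?thesis using K by (simp add: field_simps)
    qed
    have hM: "8 * M * norm h < \<beta>"
    proof -
      have "norm h < \<beta> / (8 * (M + 1))" using h by (simp add: d_def)
      then have "norm h * (8 * (M + 1)) < \<beta>" using M by (simp add: pos_less_divide_eq)
      then show ?thesis by (simp add: algebra_simps) (smt (verit) norm_ge_zero)
    qed
    have exp: "norm (D x0 h + (1/2) *\<^sub>R B h h) \<le> e * (norm h)\<^sup>2"
    proof -
      have "norm (- (D x0 h + (1/2) *\<^sub>R B h h)) \<le> e * (norm h)\<^sup>2"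
        using d0(2)[of h] h g0 by (simp add: d_def)
      then show ?thesis by (metis norm_minus_cancel)
    qed
    have B2: "norm (B x y) \<le> norm B * norm x * norm y" for x y
      by (meson dual_order.trans mult_right_mono norm_blinfun norm_ge_zero)
    have "norm (D x0 h) \<le> norm (D x0 h + (1/2) *\<^sub>R B h h) + norm ((1/2) *\<^sub>R B h h)"
      by (metis add_diff_cancel_right' norm_triangle_ineq4)
    also have "\<dots> \<le> e * (norm h)\<^sup>2 + norm B * (norm h)\<^sup>2"
    proof (intro add_mono exp)
      show "norm ((1/2) *\<^sub>R B h h) \<le> norm B * (norm h)\<^sup>2"
        using B2[of h h] norm_ge_zero[of "B h h"]
        unfolding norm_scaleR power2_eq_square mult.assoc by linarith
    qed
    finally have Dh: "norm (D x0 h) \<le> (norm B + e) * (norm h)\<^sup>2" by (simp add: algebra_simps)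
    obtain r where r: "D x0 r = D x0 h" "norm r \<le> C * norm (D x0 h)" using C(2) by blast
    have "C * norm (D x0 h) \<le> C * ((norm B + e) * (norm h)\<^sup>2)"
      using Dh C(1) by (intro mult_left_mono) auto
    then have rK: "norm r \<le> K * (norm h)\<^sup>2" using r(2) by (simp add: K_def mult.assoc)
    have "K * (norm h)\<^sup>2 = (norm h * K) * norm h" by (simp add: power2_eq_square)
    also have "\<dots> \<le> 1/2 * norm h" using hK by (intro mult_right_mono) auto
    finally have r2: "norm r \<le> norm h / 2" using rK by simp
    have "h - r \<in> null_space (D x0)"
      using r by (simp add: null_space_def blinfun.diff_right)
    then obtain a where a: "h - r = a *\<^sub>R v" using ker by (auto simp: span_singleton)
    then have heq: "h = a *\<^sub>R v + r" by (simp add: algebra_simps)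
    have a_norm: "\<bar>a\<bar> = norm (h - r)" using a v by simp
    have a_ge: "\<bar>a\<bar> \<ge> norm h / 2"
      using a_norm norm_triangle_ineq2[of h r] r2 by linarith
    have a_le: "\<bar>a\<bar> \<le> 2 * norm h"
      using a_norm norm_triangle_ineq4[of h r] r2 norm_ge_zero[of h] by linarith
    \<comment> \<open>Only the first argument is split in \<open>B r h\<close>, which leaves two
      cross terms, each containing the small factor \<open>r\<close>.\<close>
    have "B h h = B (a *\<^sub>R v) (a *\<^sub>R v) + B (a *\<^sub>R v) r + B r h"
      by (subst (1 2) heq) (simp add: blinfun.add_right blinfun.add_left heq)
    then have Bh: "a\<^sup>2 *\<^sub>R B v v = B h h - (B (a *\<^sub>R v) r + B r h)"
      by (simp add: blinfun.scaleR_left blinfun.scaleR_right power2_eq_square)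
    have "norm (B (a *\<^sub>R v) r + B r h) \<le> norm B * \<bar>a\<bar> * norm r + norm B * norm r * norm h"
      using B2[of "a *\<^sub>R v" r] B2[of r h] v
      by (intro order_trans[OF norm_triangle_ineq] add_mono) auto
    also have "\<dots> = norm B * norm r * (\<bar>a\<bar> + norm h)" by (simp add: algebra_simps)
    also have "\<dots> \<le> norm B * (K * (norm h)\<^sup>2) * (3 * norm h)"
      using rK a_le K by (intro mult_mono) auto
    finally have rem: "norm (B (a *\<^sub>R v) r + B r h) \<le> 3 * norm B * K * norm h * (norm h)\<^sup>2"
      by (simp add: mult_ac)
    have lB: "\<bar>l (B h h)\<bar> \<le> 2 * (\<beta> / 16 * (norm h)\<^sup>2)"
    proof -
      \<comment> \<open>\<open>l\<close> annihilates the first-order term, so only half the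
        quadratic term survives.\<close>
      have "l (D x0 h + (1/2) *\<^sub>R B h h) = l (B h h) / 2"
        by (simp add: blinfun.add_right blinfun.scaleR_right lD)
      then have "\<bar>l (B h h)\<bar> = 2 * norm (l (D x0 h + (1/2) *\<^sub>R B h h))" by simp
      also have "\<dots> \<le> 2 * (norm l * (e * (norm h)\<^sup>2))"
        using exp by (intro mult_left_mono order_trans[OF norm_blinfun]) auto
      also have "\<dots> = 2 * ((norm l * e) * (norm h)\<^sup>2)" by simp
      also have "\<dots> \<le> 2 * (\<beta> / 16 * (norm h)\<^sup>2)"
        using le by (intro mult_left_mono mult_right_mono) auto
      finally show ?thesis .
    qed
    have "norm (l (B (a *\<^sub>R v) r + B r h)) \<le> norm l * (3 * norm B * K * norm h * (norm h)\<^sup>2)"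
      using rem by (intro order_trans[OF norm_blinfun] mult_left_mono) auto
    then have lrem: "\<bar>l (B (a *\<^sub>R v) r + B r h)\<bar> \<le> M * norm h * (norm h)\<^sup>2"
      by (simp add: M_def mult_ac)
    have "a\<^sup>2 * l (B v v) = l (B h h) - l (B (a *\<^sub>R v) r + B r h)"
      using arg_cong[OF Bh, of l] by (simp add: blinfun.diff_right blinfun.scaleR_right)
    then have "a\<^sup>2 * \<beta> = \<bar>l (B h h) - l (B (a *\<^sub>R v) r + B r h)\<bar>"
      by (metis \<beta>_def abs_mult abs_power2)
    also have "\<dots> \<le> \<beta> / 8 * (norm h)\<^sup>2 + M * norm h * (norm h)\<^sup>2"
      using lB lrem by linarith
    \<comment> \<open>Strictness needs \<open>h\<close> nonzero. The two shares of 1/8 add up to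
      1/4, matching the lower bound on |a|.\<close>
    also have "\<dots> < \<beta> / 8 * (norm h)\<^sup>2 + \<beta> / 8 * (norm h)\<^sup>2"
      using hM h(3) by (intro add_strict_left_mono mult_strict_right_mono) auto
    also have "\<dots> = (norm h / 2)\<^sup>2 * \<beta>" by (simp add: power2_eq_square)
    also have "\<dots> \<le> a\<^sup>2 * \<beta>"
      using a_ge \<beta> by (intro mult_right_mono abs_le_square_iff[THEN iffD1]) auto
    finally show False by simp
  qed
qed

section \<open>Differentials, codimension one, and transversality\<close>

lemma has_derivative_differential:
  assumes "g differentiable (at x)"
  shows "(g has_derivative differential g x) (at x)"
  using assms differential_eq
  by (metis bounded_linear_Blinfun_apply has_derivative_bounded_linear differentiable_def)

lemma blinfun_invertible_bounded_below:
  assumes "blinfun_invertible L"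
  obtains c where "c > 0" "\<And>h. c * norm h \<le> norm (blinfun_apply L h)"
proof -
  obtain M where M: "M o\<^sub>L L = id_blinfun"
    using assms by (auto simp: blinfun_invertible_def)
  \<comment> \<open>The left inverse gives the lower bound; adding 1 avoids dividing by zero when
    \<open>M = 0\<close>.\<close>
  show thesis
  proof (rule that[of "1 / (norm M + 1)"])
    show "1 / (norm M + 1) > 0" by (simp add: add_nonneg_pos)
    fix h
    have "norm h = norm (M (L h))"
      using M by (metis blinfun_apply_blinfun_compose blinfun_apply_id_blinfun)
    also have "\<dots> \<le> norm M * norm (L h)" by (rule norm_blinfun)
    also have "\<dots> \<le> (norm M + 1) * norm (L h)" by (intro mult_right_mono) auto
    finally show "1 / (norm M + 1) * norm h \<le> norm (L h)"
      by (simp add: add_nonneg_pos pos_divide_le_eq mult.commute)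
  qed
qed

lemma codim_1_quotient_basis:
  assumes "codim W = 1"
  obtains w where "quotient_basis W {w}"
proof -
  define B where "B = (SOME B. finite B \<and> quotient_basis W B)"
  \<comment> \<open>The default value 0 of \<open>codim\<close> differs from 1, so the codimension
    is genuinely finite.\<close>
  have fc: "fin_codim W" using assms by (auto simp: codim_def split: if_splits)
  then have "quotient_basis W B"
    unfolding B_def fin_codim_def by (metis (mono_tags, lifting) someI_ex)
  moreover have "card B = 1" using assms fc by (simp add: codim_def B_def)
  ultimately show thesis using that card_1_singletonE by metis
qed

lemma dim_1_unit_vector:
  fixes V :: "'a::real_normed_vector set"
  assumes "subspace V" "dim V = 1"
  obtains v where "norm v = 1" "V = span {v}"
proof -
  obtain B where B: "B \<subseteq> V" "independent B" "V \<subseteq> span B" "card B = 1"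
    using basis_exists[of V] assms(2) by metis
  then obtain b where b: "B = {b}" by (metis card_1_singletonE)
  have b0: "b \<noteq> 0" using B(2) b by (auto simp: dependent_zero)
  have V: "V = span {b}" using B b assms(1) by (simp add: span_minimal subset_antisym)
  have "V = span {b /\<^sub>R norm b}"
  proof -
    have "span {b /\<^sub>R norm b} = span {b}"
    proof (rule subset_antisym; rule span_minimal)
      show "{b /\<^sub>R norm b} \<subseteq> span {b}" by (simp add: span_base span_scale)
      have "norm b *\<^sub>R (b /\<^sub>R norm b) \<in> span {b /\<^sub>R norm b}" by (intro span_scale span_base) simp
      then show "{b} \<subseteq> span {b /\<^sub>R norm b}" using b0 by simp
    qed (rule subspace_span)+
    then show ?thesis using V by simp
  qed
  moreover have "norm (b /\<^sub>R norm b) = 1" using b0 by simp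
  ultimately show thesis using that by blast
qed

text \<open>Freezing \<open>t\<close> is composition with the affine embedding of \<open>x\<close>
  as \<open>(x, t)\<close>, whose linear part is \<open>\<iota>\<close>. The chain rule gives
  \<open>Dx\<close>, and composing the differential of \<open>differential f\<close> with
  \<open>\<iota>\<close> on both sides gives \<open>Dxx\<close>.\<close>

lemma C2_on_partial_derivatives:
  fixes f :: "'a::real_normed_vector \<times> real \<Rightarrow> 'b::real_normed_vector"
  assumes f: "C2_on (X \<times> {0<..<T}) f" and X: "open X" and x: "x \<in> X" and t: "t \<in> {0<..<T}"
  shows has_derivative_Dx: "((\<lambda>x. f (x, t)) has_derivative Dx f x t) (at x)"
    and has_derivative_Dxx: "((\<lambda>x. Dx f x t) has_derivative Dxx f x t) (at x)"
proof -
  define \<iota> :: "'a \<Rightarrow>\<^sub>L ('a \<times> real)" where "\<iota> = Blinfun (\<lambda>h. (h, 0))"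
  have \<iota>: "blinfun_apply \<iota> h = (h, 0)" for h
    unfolding \<iota>_def by (simp add: bounded_linear_Blinfun_apply bounded_linear_Pair)
  have emb: "((\<lambda>x. (x, t)) has_derivative \<iota>) (at y)" for y :: 'a
    using has_derivative_Pair[OF has_derivative_ident has_derivative_const, of t y UNIV]
    by (simp add: \<iota>[abs_def])
  have d1: "((\<lambda>x. f (x, t)) has_derivative blinfun_apply (differential f (y, t) o\<^sub>L \<iota>)) (at y)"
    if "y \<in> X" for y
  proof -
    have "f differentiable (at (y, t))" using f that t by (auto simp: C2_on_def C1_on_def)
    from has_derivative_compose[OF emb has_derivative_differential[OF this]]
    show ?thesis by (simp add: comp_def blinfun_compose.rep_eq)
  qed
  then have Dx_eq: "Dx f y t = differential f (y, t) o\<^sub>L \<iota>" if "y \<in> X" for y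
    unfolding Dx_def using that by (intro differential_eq) auto
  then show "((\<lambda>x. f (x, t)) has_derivative Dx f x t) (at x)" using d1 x by simp
  have "differential f differentiable (at (x, t))"
    using f x t by (auto simp: C2_on_def C1_on_def)
  from has_derivative_compose[OF emb has_derivative_differential[OF this]]
  have "((\<lambda>x. differential f (x, t) o\<^sub>L \<iota>) has_derivative
      (\<lambda>h. differential (differential f) (x, t) (\<iota> h) o\<^sub>L \<iota>)) (at x)"
    by (rule bounded_linear.has_derivative[OF bounded_bilinear.bounded_linear_left
        [OF bounded_bilinear_blinfun_compose]])
  then have "((\<lambda>x. Dx f x t) has_derivative
      (\<lambda>h. differential (differential f) (x, t) (\<iota> h) o\<^sub>L \<iota>)) (at x)"
    \<comment> \<open>The formula for \<open>Dx\<close> is available only on \<open>X\<close>;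
      openness makes this enough to differentiate it at \<open>x\<close>.\<close>
    by (rule has_derivative_transform_within_open[OF _ X x]) (simp add: Dx_eq)
  then show "((\<lambda>x. Dx f x t) has_derivative Dxx f x t) (at x)"
    unfolding Dxx_def by (intro has_derivative_differential) (auto simp: differentiable_def)
qed

theorem theorem2p5:
  fixes X :: "'a::banach set" and T :: real and f :: "'a \<times> real \<Rightarrow> 'b::banach"
  assumes "0 < T"
    and "open X" and "connected X"
    and "C2_on (X \<times> {0<..<T}) f"
    and "\<And>t. t \<in> {0<..<T} \<Longrightarrow> fredholm_map_on X 0 (\<lambda>x. f (x, t))"
    and "transversality f X T"
  shows "\<forall>t \<in> {0<..<T}. \<forall>x \<in> {x \<in> X. f (x, t) = 0}. x isolated_in {x \<in> X. f (x, t) = 0}"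
proof (intro ballI)
  fix t x0 assume t: "t \<in> {0<..<T}" and "x0 \<in> {x \<in> X. f (x, t) = 0}"
  then have x0: "x0 \<in> X" "f (x0, t) = 0" by auto
  note der = C2_on_partial_derivatives[OF assms(4,2) _ t]
  have "\<exists>d>0. \<forall>h. norm h < d \<longrightarrow> f (x0 + h, t) = 0 \<longrightarrow> h = 0"
  proof (cases "blinfun_invertible (Dx f x0 t)")
    case True
    then obtain c where "c > 0" "\<And>h. c * norm h \<le> norm (Dx f x0 t h)"
      using blinfun_invertible_bounded_below by blast
    with isolated_zero_bounded_below[where g = "\<lambda>x. f (x, t)", OF der(1)[OF x0(1)] x0(2)]
    show ?thesis by blast
  next
    case False
    then have "(x0, t) \<in> singular_set f X T"
      using x0 t by (simp add: singular_set_def zero_set_def)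
    then have T1: "T1 f x0 t" and T3: "T3 f x0 t"
      using assms(6) by (auto simp: transversality_def)
    have dim: "dim (null_space (Dx f x0 t)) = 1" using T1 by (simp add: T1_def)
    \<comment> \<open>Index 0 converts the one-dimensional kernel from \<open>T1\<close> into a
      range of codimension one.\<close>
    have "fredholm_index (Dx f x0 t) = 0"
      using assms(5)[OF t] x0(1) by (simp add: fredholm_map_on_def Dx_def)
    then have "codim (range_space (Dx f x0 t)) = 1" using dim by (simp add: fredholm_index_def)
    then obtain w where "quotient_basis (range_space (Dx f x0 t)) {w}"
      using codim_1_quotient_basis by blast
    then obtain l C where l: "l \<noteq> 0" "l \<in> null_space (blinfun_adjoint (Dx f x0 t))"
      and C: "C > 0" "\<And>h. \<exists>u. Dx f x0 t u = Dx f x0 t h \<and> norm u \<le> C * norm (Dx f x0 t h)"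
      using codim_1_functional by blast
    have "subspace (null_space (Dx f x0 t))"
      by (auto simp: subspace_def null_space_def blinfun.add_right blinfun.scaleR_right)
    then obtain v where v: "norm v = 1" "null_space (Dx f x0 t) = span {v}"
      using dim_1_unit_vector dim by blast
    have "v \<in> null_space (Dx f x0 t)" "v \<noteq> 0" using v by (auto simp: span_base)
    then have "l (Dxx f x0 t v v) \<noteq> 0" using T3 l by (auto simp: T3_def)
    with v(2) show ?thesis
      by (intro isolated_zero_fold[where g = "\<lambda>x. f (x, t)" and D = "\<lambda>x. Dx f x t",
          OF assms(2) x0(1) der(1) der(2)[OF x0(1)] x0(2) _ v(1) l(2) _ C]) simp_all
  qed
  then obtain d where d: "d > 0" "\<And>h. norm h < d \<Longrightarrow> f (x0 + h, t) = 0 \<Longrightarrow> h = 0" by blast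
  have "y = x0" if "y \<in> X" "f (y, t) = 0" "dist x0 y < d" for y
    using d(2)[of "y - x0"] that by (simp add: dist_norm norm_minus_commute)
  then show "x0 isolated_in {x \<in> X. f (x, t) = 0}"
    unfolding isolated_in_dist_Ex_iff using x0 d(1) by blast
qed

end
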